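(* Let $S$ be a normalizing Krull monoid. Then, for all $a\in S$, $\omega_p(S,a)<\infty$ and $\omega_p'(S,a)<\infty$.
   Context: Semigroups have a neutral element. A semigroup $S$ is normalizing if $aS=Sa$ for all $a\in S$. A Krull monoid is a cancellative semigroup $S$ that is left and right Ore, is a maximal order in its quotient group $Q$, and satisfies the ACC on divisorial $S$-ideals. Here: a subsemigroup $S\subset Q$ is an order in $Q$ if every $q\in Q$ can be written $q=ac^{-1}=d^{-1}b$ with $a,b,c,d\in S$; orders $S,S'$ are equivalent if $aSb\subset S'$ and $cS'd\subset S$ for some $a,b,c,d\in Q$; a maximal order is one that is maximal under inclusion in its equivalence class. A fractional left $S$-ideal is a nonempty $I\subset Q$ with $SI\subset I$ and $Iy\subset S$ for some $y\in Q$; fractional right $S$-ideals are analogous; a fractional $S$-ideal is both, and an $S$-ideal if contained in $S$. $I^{-1}=\{q\in Q:IqI\subset I\}$, $I_v=(I^{-1})^{-1}$, and $I$ is divisorial if $I=I_v$. $S^\times$ denotes the units; $a\simeq b$ if $b=\varepsilon a\eta$ with $\varepsilon,\eta\in S^\times$; an atom is a non-unit $u$ such that $u=ab$ implies $a$ or $b$ is a unit. Such $S$ is atomic (every non-unit is a finite product of atoms). For $a,b\in S$ write $a\mid_p b$ if there are $k,l\in\mathbb N_0$, units $\varepsilon,\eta$, atoms $u_1,\dots,u_k,v_1,\dots,v_l$ with $a=\varepsilon u_1\cdots u_k$, $b=\eta v_1\cdots v_l$, $k\le l$, and an injective map $\sigma:[1,k]\to[1,l]$ with $u_i\simeq v_{\sigma(i)}$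 for all $i$. $\omega_p'(a,b)$ is the smallest $N\in\mathbb N_0\cup\{\infty\}$ such that: for all $n\in\mathbb N$ and $a_1,\dots,a_n\in S$ with $a=a_1\cdots a_n$, if $b\mid_p a$, then there are $k\in[0,N]$ and an injective map $\sigma:[1,k]\to[1,n]$ with $b\mid_p a_{\sigma(1)}\cdots a_{\sigma(k)}$ (empty product $=1$). $\omega_p(a,b)$ is defined in the same way, but only for factorizations $a=u_1\cdots u_n$ into atoms $u_i$. $\omega_p'(S,b)=\sup_{a\in S}\omega_p'(a,b)$ and $\omega_p(S,b)=\sup_{a\in S}\omega_p(a,b)$. *)

theory Defs
  imports
    "HOL-Algebra.Coset"
    "HOL-Algebra.Divisibility"
    "HOL-Library.Extended_Nat"
begin

section \<open>Krull monoids\<close>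

definition normalizing :: "('a, 'm) monoid_scheme \<Rightarrow> bool" where
  "normalizing S \<longleftrightarrow> (\<forall>a \<in> carrier S. a <#\<^bsub>S\<^esub> carrier S = carrier S #>\<^bsub>S\<^esub> a)"

definition right_Ore :: "('a, 'm) monoid_scheme \<Rightarrow> bool" where
  "right_Ore S \<longleftrightarrow>
    (\<forall>a \<in> carrier S. \<forall>b \<in> carrier S. (a <#\<^bsub>S\<^esub> carrier S) \<inter> (b <#\<^bsub>S\<^esub> carrier S) \<noteq> {})"

definition left_Ore :: "('a, 'm) monoid_scheme \<Rightarrow> bool" where
  "left_Ore S \<longleftrightarrow>
    (\<forall>a \<in> carrier S. \<forall>b \<in> carrier S. (carrier S #>\<^bsub>S\<^esub> a) \<inter> (carrier S #>\<^bsub>S\<^esub> b) \<noteq> {})"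

text \<open>Orders are subsets of a fixed group \<open>Q\<close>.\<close>

definition order_in :: "('b, 'n) monoid_scheme \<Rightarrow> 'b set \<Rightarrow> bool" where
  "order_in Q T \<longleftrightarrow> submonoid T Q \<and>
    (\<forall>q \<in> carrier Q. \<exists>a \<in> T. \<exists>b \<in> T. \<exists>c \<in> T. \<exists>d \<in> T.
      q = a \<otimes>\<^bsub>Q\<^esub> inv\<^bsub>Q\<^esub> c \<and> q = inv\<^bsub>Q\<^esub> d \<otimes>\<^bsub>Q\<^esub> b)"

definition equivalent_orders :: "('b, 'n) monoid_scheme \<Rightarrow> 'b set \<Rightarrow> 'b set \<Rightarrow> bool" where
  "equivalent_orders Q T T' \<longleftrightarrow>
    (\<exists>a \<in> carrier Q. \<exists>b \<in> carrier Q. \<exists>c \<in> carrier Q. \<exists>d \<in> carrier Q.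
      (a <#\<^bsub>Q\<^esub> T) #>\<^bsub>Q\<^esub> b \<subseteq> T' \<and> (c <#\<^bsub>Q\<^esub> T') #>\<^bsub>Q\<^esub> d \<subseteq> T)"

definition maximal_order :: "('b, 'n) monoid_scheme \<Rightarrow> 'b set \<Rightarrow> bool" where
  "maximal_order Q T \<longleftrightarrow> order_in Q T \<and>
    (\<forall>T'. order_in Q T' \<and> equivalent_orders Q T T' \<and> T \<subseteq> T' \<longrightarrow> T' = T)"

definition fractional_left_ideal :: "('b, 'n) monoid_scheme \<Rightarrow> 'b set \<Rightarrow> 'b set \<Rightarrow> bool" where
  "fractional_left_ideal Q T I \<longleftrightarrow> I \<noteq> {} \<and> I \<subseteq> carrier Q \<and> T <#>\<^bsub>Q\<^esub> I \<subseteq> I \<and>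
    (\<exists>y \<in> carrier Q. I #>\<^bsub>Q\<^esub> y \<subseteq> T)"

definition fractional_right_ideal :: "('b, 'n) monoid_scheme \<Rightarrow> 'b set \<Rightarrow> 'b set \<Rightarrow> bool" where
  "fractional_right_ideal Q T I \<longleftrightarrow> I \<noteq> {} \<and> I \<subseteq> carrier Q \<and> I <#>\<^bsub>Q\<^esub> T \<subseteq> I \<and>
    (\<exists>y \<in> carrier Q. y <#\<^bsub>Q\<^esub> I \<subseteq> T)"

definition fractional_ideal :: "('b, 'n) monoid_scheme \<Rightarrow> 'b set \<Rightarrow> 'b set \<Rightarrow> bool" where
  "fractional_ideal Q T I \<longleftrightarrow> fractional_left_ideal Q T I \<and> fractional_right_ideal Q T I"

definition order_ideal :: "('b, 'n) monoid_scheme \<Rightarrow> 'b set \<Rightarrow> 'b set \<Rightarrow> bool" where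
  "order_ideal Q T I \<longleftrightarrow> fractional_ideal Q T I \<and> I \<subseteq> T"

definition ideal_inverse :: "('b, 'n) monoid_scheme \<Rightarrow> 'b set \<Rightarrow> 'b set" where
  "ideal_inverse Q I = {q \<in> carrier Q. (I #>\<^bsub>Q\<^esub> q) <#>\<^bsub>Q\<^esub> I \<subseteq> I}"

definition divisorial :: "('b, 'n) monoid_scheme \<Rightarrow> 'b set \<Rightarrow> bool" where
  "divisorial Q I \<longleftrightarrow> ideal_inverse Q (ideal_inverse Q I) = I"

definition acc_divisorial :: "('b, 'n) monoid_scheme \<Rightarrow> 'b set \<Rightarrow> bool" where
  "acc_divisorial Q T \<longleftrightarrow>
    (\<forall>I :: nat \<Rightarrow> 'b set.
      (\<forall>n. order_ideal Q T (I n) \<and> divisorial Q (I n)) \<and> (\<forall>n. I n \<subseteq> I (Suc n))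
      \<longrightarrow> (\<exists>n. \<forall>m \<ge> n. I m = I n))"

text \<open>The quotient group of \<open>S\<close> is unique only up to isomorphism, so it is carried along as a
  group \<open>Q\<close> with an embedding \<open>\<iota>\<close> of \<open>S\<close>; \<open>\<iota> ` carrier S\<close> plays the role of \<open>S \<subseteq> Q\<close>.\<close>

definition quotient_group ::
  "('a, 'm) monoid_scheme \<Rightarrow> ('b, 'n) monoid_scheme \<Rightarrow> ('a \<Rightarrow> 'b) \<Rightarrow> bool" where
  "quotient_group S Q \<iota> \<longleftrightarrow>
    group Q \<and> \<iota> \<in> hom S Q \<and> inj_on \<iota> (carrier S) \<and> order_in Q (\<iota> ` carrier S)"

definition krull_monoid ::
  "('a, 'm) monoid_scheme \<Rightarrow> ('b, 'n) monoid_scheme \<Rightarrow> ('a \<Rightarrow> 'b) \<Rightarrow> bool" where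
  "krull_monoid S Q \<iota> \<longleftrightarrow>
    monoid_cancel S \<and> left_Ore S \<and> right_Ore S \<and> quotient_group S Q \<iota> \<and>
    maximal_order Q (\<iota> ` carrier S) \<and> acc_divisorial Q (\<iota> ` carrier S)"

section \<open>Factorizations and the permutable omega invariants\<close>

definition unit_equiv :: "('a, 'm) monoid_scheme \<Rightarrow> 'a \<Rightarrow> 'a \<Rightarrow> bool" where
  "unit_equiv S a b \<longleftrightarrow>
    (\<exists>\<epsilon> \<in> Units S. \<exists>\<eta> \<in> Units S. b = \<epsilon> \<otimes>\<^bsub>S\<^esub> a \<otimes>\<^bsub>S\<^esub> \<eta>)"

text \<open>Not the library's \<^const>\<open>irreducible\<close>, which is phrased with one-sided divisibility.\<close>

definition atom :: "('a, 'm) monoid_scheme \<Rightarrow> 'a \<Rightarrow> bool" where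
  "atom S u \<longleftrightarrow> u \<in> carrier S \<and> u \<notin> Units S \<and>
    (\<forall>a \<in> carrier S. \<forall>b \<in> carrier S. u = a \<otimes>\<^bsub>S\<^esub> b \<longrightarrow> a \<in> Units S \<or> b \<in> Units S)"

definition list_prod :: "('a, 'm) monoid_scheme \<Rightarrow> 'a list \<Rightarrow> 'a" where
  "list_prod S xs = foldr (\<otimes>\<^bsub>S\<^esub>) xs \<one>\<^bsub>S\<^esub>"

text \<open>\<open>perm_divides S a b\<close> is $a \mid_p b$; lists are indexed from \<open>0\<close>.\<close>

definition perm_divides :: "('a, 'm) monoid_scheme \<Rightarrow> 'a \<Rightarrow> 'a \<Rightarrow> bool" where
  "perm_divides S a b \<longleftrightarrow>
    (\<exists>\<epsilon> \<in> Units S. \<exists>\<eta> \<in> Units S. \<exists>us vs. \<exists>\<sigma> :: nat \<Rightarrow> nat.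
      (\<forall>u \<in> set us. atom S u) \<and> (\<forall>v \<in> set vs. atom S v) \<and>
      a = \<epsilon> \<otimes>\<^bsub>S\<^esub> list_prod S us \<and> b = \<eta> \<otimes>\<^bsub>S\<^esub> list_prod S vs \<and>
      length us \<le> length vs \<and>
      \<sigma> \<in> {..<length us} \<rightarrow> {..<length vs} \<and> inj_on \<sigma> {..<length us} \<and>
      (\<forall>i < length us. unit_equiv S (us ! i) (vs ! \<sigma> i)))"

text \<open>A subproduct of at most \<open>N\<close> of the factors, in any order, is still permutably divisible
  by \<open>b\<close>.\<close>

definition short_subproduct :: "('a, 'm) monoid_scheme \<Rightarrow> 'a \<Rightarrow> 'a list \<Rightarrow> enat \<Rightarrow> bool" where
  "short_subproduct S b as N \<longleftrightarrow>
    (\<exists>(k :: nat) (\<sigma> :: nat \<Rightarrow> nat). enat k \<le> N \<and>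
      \<sigma> \<in> {..<k} \<rightarrow> {..<length as} \<and> inj_on \<sigma> {..<k} \<and>
      perm_divides S b (list_prod S (map (\<lambda>i. as ! \<sigma> i) [0..<k])))"

text \<open>In both minima \<open>N = \<infinity>\<close> is always admissible (take all factors), so they are attained.\<close>

definition omega_p' :: "('a, 'm) monoid_scheme \<Rightarrow> 'a \<Rightarrow> 'a \<Rightarrow> enat" where
  "omega_p' S a b = (LEAST N :: enat.
    \<forall>as. as \<noteq> [] \<and> set as \<subseteq> carrier S \<and> a = list_prod S as \<and> perm_divides S b a
      \<longrightarrow> short_subproduct S b as N)"

definition omega_p :: "('a, 'm) monoid_scheme \<Rightarrow> 'a \<Rightarrow> 'a \<Rightarrow> enat" where
  "omega_p S a b = (LEAST N :: enat.
    \<forall>us. us \<noteq> [] \<and> (\<forall>u \<in> set us. atom S u) \<and> a = list_prod S us \<and> perm_divides S b a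
      \<longrightarrow> short_subproduct S b us N)"

definition omega_p'_sup :: "('a, 'm) monoid_scheme \<Rightarrow> 'a \<Rightarrow> enat" where
  "omega_p'_sup S b = (SUP a \<in> carrier S. omega_p' S a b)"

definition omega_p_sup :: "('a, 'm) monoid_scheme \<Rightarrow> 'a \<Rightarrow> enat" where
  "omega_p_sup S b = (SUP a \<in> carrier S. omega_p S a b)"

end

theory Submission
  imports Defs
begin

text \<open>In the quotient group \<open>Q\<close> a normalizing Krull monoid \<open>T\<close> is stable under conjugation and, being
  a maximal order, completely integrally closed.  By the ACC, among the ideals
  \<open>{a \<in> T. a q \<in> T}\<close> with \<open>q \<notin> T\<close> there are maximal ones; these are completely prime, and each
  carries an additive valuation, for which \<open>q\<close> serves as the inverse of a uniformizer.
  Every element has finite support, and the valuations detect divisibility.  Although \<open>T\<close> need not be commutative,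
  permutable divisibility therefore just compares valuations, and a product divisible by \<open>b\<close> has
  a subproduct of at most \<open>\<Sum>\<^sub>v v(b)\<close> factors that is: for each \<open>v\<close>, at most \<open>v(b)\<close> factors
  of positive valuation suffice.\<close>

section \<open>Monoids with a defining family of valuations\<close>

text \<open>While \<open>J\<close> falls short of the target, some element outside \<open>J\<close>
  has positive value. Values are natural numbers, so adding it gains at least one.\<close>

lemma exists_small_subset_sum_ge:
  fixes f :: "'b \<Rightarrow> nat"
  assumes "finite A" "m \<le> sum f A"
  shows "\<exists>J \<subseteq> A. card J \<le> m \<and> m \<le> sum f J"
  using assms
proof (induction m)
  case 0
  show ?case by (rule exI[of _ "{}"]) simp
next
  case (Suc m)
  then obtain J where J: "J \<subseteq> A" "card J \<le> m" "m \<le> sum f J"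
    by auto
  show ?case
  proof (cases "Suc m \<le> sum f J")
    case True
    then show ?thesis using J by (intro exI[of _ J]) auto
  next
    case False
    have fJ: "finite J" using J(1) Suc.prems(1) finite_subset by blast
    have "\<exists>x\<in>A - J. 0 < f x"
    proof (rule ccontr)
      assume "\<not> ?thesis"
      then have "sum f (A - J) = 0" by simp
      then have "sum f A = sum f J"
        using sum.subset_diff[OF J(1) Suc.prems(1), of f] by simp
      then show False using Suc.prems(2) False by simp
    qed
    then obtain x where x: "x \<in> A" "x \<notin> J" "0 < f x" by blast
    show ?thesis
      using x J fJ by (intro exI[of _ "insert x J"]) auto
  qed
qed

text \<open>No quotient group appears here: beyond cancellation and normality, counting factors
  needs only additivity, finite supports and a test for divisibility.\<close>

locale valued_monoid = monoid_cancel S for S :: "('a, 'm) monoid_scheme" (structure) +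
  fixes V :: "'i set" and w :: "'i \<Rightarrow> 'a \<Rightarrow> nat"
  assumes normal: "a \<in> carrier S \<Longrightarrow> a <# carrier S = carrier S #> a"
    and w_mult: "i \<in> V \<Longrightarrow> a \<in> carrier S \<Longrightarrow> b \<in> carrier S \<Longrightarrow> w i (a \<otimes> b) = w i a + w i b"
    and w_dvd: "a \<in> carrier S \<Longrightarrow> b \<in> carrier S \<Longrightarrow> (\<And>i. i \<in> V \<Longrightarrow> w i a \<le> w i b)
                  \<Longrightarrow> \<exists>c \<in> carrier S. b = c \<otimes> a"
    and finite_supp: "a \<in> carrier S \<Longrightarrow> finite {i \<in> V. 0 < w i a}"
begin

text \<open>The degree of the divisor of \<open>a\<close>. The sum runs over the support because
  \<open>V\<close> may be infinite, and a sum over an infinite set would be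
  \<open>0\<close>.\<close>

definition weight :: "'a \<Rightarrow> nat" where
  "weight a = (\<Sum>i | i \<in> V \<and> 0 < w i a. w i a)"

lemma w_one: "i \<in> V \<Longrightarrow> w i \<one> = 0"
  using w_mult[of i \<one> \<one>] by simp

lemma w_unit:
  assumes "i \<in> V" "u \<in> Units S"
  shows "w i u = 0"
proof -
  have "w i (u \<otimes> inv u) = w i u + w i (inv u)" using assms by (intro w_mult) auto
  then show ?thesis using assms w_one by simp
qed

text \<open>The divisibility test only yields a left inverse \<open>c\<close>; cancelling
  \<open>a\<close> on the right in \<open>a c a = a\<close> makes it two-sided.\<close>

lemma unitI:
  assumes a: "a \<in> carrier S" and "\<And>i. i \<in> V \<Longrightarrow> w i a = 0"
  shows "a \<in> Units S"
proof -
  obtain c where c: "c \<in> carrier S" "\<one> = c \<otimes> a"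
    using w_dvd[of a \<one>] assms by auto
  have "(a \<otimes> c) \<otimes> a = \<one> \<otimes> a" using a c by (simp add: m_assoc[of a c a] c(2)[symmetric])
  then have "a \<otimes> c = \<one>" using a c r_cancel by blast
  then show ?thesis using a c unfolding Units_def by auto
qed

lemma weight_eq:
  assumes "a \<in> carrier S" "finite A" "{i \<in> V. 0 < w i a} \<subseteq> A" "A \<subseteq> V"
  shows "weight a = (\<Sum>i\<in>A. w i a)"
  unfolding weight_def using assms by (intro sum.mono_neutral_left) auto

lemma weight_mult:
  assumes "a \<in> carrier S" "b \<in> carrier S"
  shows "weight (a \<otimes> b) = weight a + weight b"
proof -
  let ?A = "{i \<in> V. 0 < w i a} \<union> {i \<in> V. 0 < w i b}"
  have f: "finite ?A" using assms finite_supp by simp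
  have "weight (a \<otimes> b) = (\<Sum>i\<in>?A. w i (a \<otimes> b))"
    using assms f w_mult by (intro weight_eq) auto
  also have "\<dots> = (\<Sum>i\<in>?A. w i a) + (\<Sum>i\<in>?A. w i b)"
    unfolding sum.distrib[symmetric] using assms w_mult by (intro sum.cong) auto
  also have "\<dots> = weight a + weight b"
    using assms f by (simp add: weight_eq[of a ?A] weight_eq[of b ?A])
  finally show ?thesis .
qed

lemma weight_pos:
  assumes "a \<in> carrier S" "a \<notin> Units S"
  shows "0 < weight a"
proof -
  obtain i where "i \<in> V" "0 < w i a" using unitI assms by auto
  then show ?thesis
    unfolding weight_def using finite_supp[OF assms(1)] by (intro sum_pos2[where i = i]) auto
qed

text \<open>Normality supplies some \<open>u'\<close>, and comparing valuations shows that
  \<open>u'\<close> has value zero everywhere. This lets units travel to the front of a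
  product.\<close>

lemma unit_left:
  assumes "x \<in> carrier S" "u \<in> Units S"
  shows "\<exists>u' \<in> Units S. x \<otimes> u = u' \<otimes> x"
proof -
  have "x \<otimes> u \<in> x <# carrier S" using assms unfolding l_coset_def by auto
  then obtain u' where u': "u' \<in> carrier S" "x \<otimes> u = u' \<otimes> x"
    using normal[OF assms(1)] unfolding r_coset_def by auto
  have "w i u' = 0" if "i \<in> V" for i
  proof -
    have "w i x + w i u = w i u' + w i x"
      using u' assms that w_mult[of i x u] w_mult[of i u' x] by auto
    then show ?thesis using w_unit assms that by simp
  qed
  then show ?thesis using u' unitI by blast
qed

section \<open>Products of lists and atomic factorizations\<close>

lemma list_prod_closed [simp]: "set xs \<subseteq> carrier S \<Longrightarrow> list_prod S xs \<in> carrier S"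
  by (induction xs) (auto simp: list_prod_def)

lemma list_prod_append:
  assumes "set xs \<subseteq> carrier S" "set ys \<subseteq> carrier S"
  shows "list_prod S (xs @ ys) = list_prod S xs \<otimes> list_prod S ys"
  using assms(1)
proof (induction xs)
  case Nil
  then show ?case using list_prod_closed[OF assms(2)] by (simp add: list_prod_def)
next
  case (Cons x xs)
  then show ?case
    using list_prod_closed[OF assms(2)] list_prod_closed[of xs]
    by (simp add: list_prod_def m_assoc)
qed

lemma w_list_prod:
  assumes "i \<in> V" "set xs \<subseteq> carrier S"
  shows "w i (list_prod S xs) = (\<Sum>j<length xs. w i (xs ! j))"
proof -
  have "w i (list_prod S xs) = sum_list (map (w i) xs)"
    using assms(2)
  proof (induction xs)
    case Nil
    then show ?case using w_one assms(1) by (simp add: list_prod_def)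
  next
    case (Cons x xs)
    then show ?case
      using w_mult[OF assms(1), of x "list_prod S xs"] list_prod_closed[of xs]
      by (simp add: list_prod_def)
  qed
  then show ?thesis by (simp add: sum_list_sum_nth atLeast0LessThan)
qed

text \<open>The weight is additive and positive on non-units, so both factors of a proper splitting
  have smaller weight. The unit of the second factorization is moved to the front by
  \<open>unit_left\<close>.\<close>

lemma atomic:
  assumes "a \<in> carrier S"
  shows "\<exists>\<epsilon> \<in> Units S. \<exists>us. (\<forall>u \<in> set us. atom S u) \<and> a = \<epsilon> \<otimes> list_prod S us"
  using assms
proof (induction "weight a" arbitrary: a rule: less_induct)
  case less
  show ?case
  proof (cases "a \<in> Units S \<or> atom S a")
    case True
    then show ?thesis
    proof
      assume "a \<in> Units S"
      then show ?thesis
        using less.prems by (intro bexI[of _ a] exI[of _ "[]"]) (auto simp: list_prod_def)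
    next
      assume "atom S a"
      then show ?thesis
        using less.prems by (intro bexI[of _ \<one>] exI[of _ "[a]"]) (auto simp: list_prod_def)
    qed
  next
    case False
    then obtain b c where bc: "b \<in> carrier S" "c \<in> carrier S" "a = b \<otimes> c"
      "b \<notin> Units S" "c \<notin> Units S"
      using less.prems unfolding atom_def by auto
    have "weight b < weight a" "weight c < weight a"
      using bc weight_mult weight_pos by auto
    then obtain \<epsilon> us \<eta> vs where us: "\<epsilon> \<in> Units S" "\<forall>u\<in>set us. atom S u" "b = \<epsilon> \<otimes> list_prod S us"
      and vs: "\<eta> \<in> Units S" "\<forall>u\<in>set vs. atom S u" "c = \<eta> \<otimes> list_prod S vs"
      using less.hyps[of b] less.hyps[of c] bc by metis
    have sub: "set us \<subseteq> carrier S" "set vs \<subseteq> carrier S"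
      using us vs by (auto simp: atom_def)
    obtain \<eta>' where e: "\<eta>' \<in> Units S" "list_prod S us \<otimes> \<eta> = \<eta>' \<otimes> list_prod S us"
      using unit_left[of "list_prod S us" \<eta>] sub vs by auto
    have "a = \<epsilon> \<otimes> (list_prod S us \<otimes> \<eta>) \<otimes> list_prod S vs"
      using bc us vs sub by (simp add: m_assoc Units_closed)
    also have "\<dots> = \<epsilon> \<otimes> \<eta>' \<otimes> list_prod S (us @ vs)"
      using e us sub by (simp add: m_assoc Units_closed list_prod_append)
    finally show ?thesis
      using e us vs by (intro bexI[of _ "\<epsilon> \<otimes> \<eta>'"] exI[of _ "us @ vs"]) auto
  qed
qed

section \<open>Permutable divisibility and the bound on subproducts\<close>

text \<open>Forwards: units have value zero, matched atoms have equal values, and the remaining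
  atoms only add. Backwards: \<open>a = d b\<close> for some \<open>d\<close>, and the
  factorizations of \<open>d\<close> and \<open>b\<close> are concatenated, so the matching is a
  shift past the atoms of \<open>d\<close>.\<close>

lemma perm_divides_iff:
  assumes b: "b \<in> carrier S" and a: "a \<in> carrier S"
  shows "perm_divides S b a \<longleftrightarrow> (\<forall>i \<in> V. w i b \<le> w i a)"
proof
  assume "perm_divides S b a"
  then obtain \<epsilon> \<eta> us vs and \<sigma> :: "nat \<Rightarrow> nat"
    where eps: "\<epsilon> \<in> Units S" "\<eta> \<in> Units S"
      and at: "\<forall>u \<in> set us. atom S u" "\<forall>v \<in> set vs. atom S v"
      and eq: "b = \<epsilon> \<otimes> list_prod S us" "a = \<eta> \<otimes> list_prod S vs"
      and s: "\<sigma> \<in> {..<length us} \<rightarrow> {..<length vs}" "inj_on \<sigma> {..<length us}"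
      and ue: "\<forall>i < length us. unit_equiv S (us ! i) (vs ! \<sigma> i)"
    unfolding perm_divides_def by blast
  have sub: "set us \<subseteq> carrier S" "set vs \<subseteq> carrier S"
    using at by (auto simp: atom_def)
  show "\<forall>i\<in>V. w i b \<le> w i a"
  proof
    fix i assume i: "i \<in> V"
    have ueq: "w i (vs ! \<sigma> j) = w i (us ! j)" if "j < length us" for j
    proof -
      obtain e f where "e \<in> Units S" "f \<in> Units S" "vs ! \<sigma> j = e \<otimes> us ! j \<otimes> f"
        using ue \<open>j < length us\<close> unfolding unit_equiv_def by auto
      moreover have "us ! j \<in> carrier S" using sub that by auto
      ultimately show ?thesis using i w_mult w_unit by (simp add: Units_closed)
    qed
    have "w i b = (\<Sum>j<length us. w i (us ! j))"
      using eq i eps sub w_mult[of i \<epsilon> "list_prod S us"] w_unit w_list_prod by auto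
    also have "\<dots> = (\<Sum>j<length us. w i (vs ! \<sigma> j))" using ueq by simp
    also have "\<dots> = (\<Sum>k\<in>\<sigma> ` {..<length us}. w i (vs ! k))"
      using s by (simp add: sum.reindex)
    also have "\<dots> \<le> (\<Sum>k<length vs. w i (vs ! k))"
      using s by (intro sum_mono2) auto
    also have "\<dots> = w i a"
      using eq i eps sub w_mult[of i \<eta> "list_prod S vs"] w_unit w_list_prod by auto
    finally show "w i b \<le> w i a" .
  qed
next
  assume "\<forall>i \<in> V. w i b \<le> w i a"
  then obtain d where d: "d \<in> carrier S" "a = d \<otimes> b" using w_dvd a b by blast
  obtain \<epsilon> us \<eta> vs where us: "\<epsilon> \<in> Units S" "\<forall>u\<in>set us. atom S u" "b = \<epsilon> \<otimes> list_prod S us"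
    and vs: "\<eta> \<in> Units S" "\<forall>u\<in>set vs. atom S u" "d = \<eta> \<otimes> list_prod S vs"
    using atomic[OF b] atomic[OF d(1)] by metis
  have sub: "set us \<subseteq> carrier S" "set vs \<subseteq> carrier S"
    using us vs by (auto simp: atom_def)
  obtain \<epsilon>' where e: "\<epsilon>' \<in> Units S" "list_prod S vs \<otimes> \<epsilon> = \<epsilon>' \<otimes> list_prod S vs"
    using unit_left[of "list_prod S vs" \<epsilon>] sub us by auto
  have "a = \<eta> \<otimes> (list_prod S vs \<otimes> \<epsilon>) \<otimes> list_prod S us"
    using d us vs sub by (simp add: m_assoc Units_closed)
  also have "\<dots> = \<eta> \<otimes> \<epsilon>' \<otimes> list_prod S (vs @ us)"
    using e vs sub by (simp add: m_assoc Units_closed list_prod_append)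
  finally have a_eq: "a = \<eta> \<otimes> \<epsilon>' \<otimes> list_prod S (vs @ us)" .
  have refl: "unit_equiv S x x" if "x \<in> carrier S" for x
    using that unfolding unit_equiv_def by (intro bexI[of _ \<one>]) auto
  show "perm_divides S b a"
    unfolding perm_divides_def
    using us vs e sub a_eq
    by (intro bexI[of _ \<epsilon>] bexI[of _ "\<eta> \<otimes> \<epsilon>'"] exI[of _ us] exI[of _ "vs @ us"]
        exI[of _ "\<lambda>i. length vs + i"]) (auto intro!: refl inj_onI)
qed

text \<open>For each \<open>i\<close> in the support of \<open>b\<close>, at most
  \<open>w i b\<close> positions already reach the value \<open>w i b\<close>; the union of these
  choices has at most \<open>weight b\<close> positions.\<close>

lemma short_subproduct_weight:
  assumes b: "b \<in> carrier S" and as: "set as \<subseteq> carrier S"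
    and dvd: "perm_divides S b (list_prod S as)"
  shows "short_subproduct S b as (enat (weight b))"
proof -
  let ?n = "length as" and ?A = "{i \<in> V. 0 < w i b}"
  have le: "w i b \<le> (\<Sum>j<?n. w i (as ! j))" if "i \<in> V" for i
    using dvd that b as by (simp add: perm_divides_iff w_list_prod)
  have "\<forall>i \<in> ?A. \<exists>J. J \<subseteq> {..<?n} \<and> card J \<le> w i b \<and> w i b \<le> (\<Sum>j\<in>J. w i (as ! j))"
    using exists_small_subset_sum_ge[of "{..<?n}"] le by simp
  then obtain J where J: "\<And>i. i \<in> ?A \<Longrightarrow> J i \<subseteq> {..<?n} \<and> card (J i) \<le> w i b \<and>
      w i b \<le> (\<Sum>j\<in>J i. w i (as ! j))" by metis
  define K where "K = (\<Union>i\<in>?A. J i)"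
  have K: "K \<subseteq> {..<?n}" "finite K"
    using J finite_subset[of K "{..<?n}"] unfolding K_def by blast+
  have fA: "finite ?A" by (rule finite_supp[OF b])
  have "card K \<le> (\<Sum>i\<in>?A. card (J i))"
    unfolding K_def by (rule card_UN_le[OF fA])
  also have "\<dots> \<le> weight b" unfolding weight_def using J by (intro sum_mono) auto
  finally have card: "card K \<le> weight b" .
  \<comment> \<open>Any enumeration of \<open>K\<close> would do, since valuations do not see the
    order of the factors.\<close>
  let ?l = "sorted_list_of_set K"
  have l: "length ?l = card K" "set ?l = K" "distinct ?l" using K by auto
  define \<sigma> where "\<sigma> i = ?l ! i" for i
  have inj: "inj_on \<sigma> {..<card K}"
    using l unfolding \<sigma>_def inj_on_def by (auto simp: nth_eq_iff_index_eq)
  have img: "\<sigma> ` {..<card K} = K"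
    unfolding \<sigma>_def using l by (metis atLeast0LessThan list.set_map map_nth set_upt)
  let ?xs = "map (\<lambda>i. as ! \<sigma> i) [0..<card K]"
  have sub: "set ?xs \<subseteq> carrier S"
  proof
    fix x assume "x \<in> set ?xs"
    then obtain i where "i < card K" "x = as ! \<sigma> i" by auto
    moreover from this have "\<sigma> i < ?n" using img K(1) by blast
    ultimately show "x \<in> carrier S" using as by auto
  qed
  have "w i b \<le> w i (list_prod S ?xs)" if i: "i \<in> V" for i
  proof (cases "i \<in> ?A")
    case True
    have "w i b \<le> (\<Sum>j\<in>J i. w i (as ! j))" using J True by blast
    also have "\<dots> \<le> (\<Sum>j\<in>K. w i (as ! j))"
      using True K by (intro sum_mono2) (auto simp: K_def)
    also have "\<dots> = (\<Sum>k<card K. w i (as ! \<sigma> k))"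
      using sum.reindex[OF inj, of "\<lambda>j. w i (as ! j)"] img by simp
    also have "\<dots> = w i (list_prod S ?xs)"
      using w_list_prod[OF i sub] by simp
    finally show ?thesis .
  next
    case False
    then show ?thesis using i by simp
  qed
  then have "perm_divides S b (list_prod S ?xs)"
    using perm_divides_iff[OF b list_prod_closed[OF sub]] by simp
  then show ?thesis
    unfolding short_subproduct_def using card inj img K(1)
    by (intro exI[of _ "card K"] exI[of _ \<sigma>]) auto
qed

lemma omega_p_sup_le:
  assumes "b \<in> carrier S"
  shows "omega_p_sup S b \<le> enat (weight b)"
proof -
  have "set us \<subseteq> carrier S" if "\<forall>u \<in> set us. atom S u" for us
    using that by (auto simp: atom_def)
  then show ?thesis
    unfolding omega_p_sup_def omega_p_def
    using short_subproduct_weight[OF assms] by (intro SUP_least Least_le) auto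
qed

lemma omega_p'_sup_le:
  assumes "b \<in> carrier S"
  shows "omega_p'_sup S b \<le> enat (weight b)"
  unfolding omega_p'_sup_def omega_p'_def
  using short_subproduct_weight[OF assms] by (intro SUP_least Least_le) auto

end

section \<open>Valuations of a normal, completely integrally closed order\<close>

lemma (in group) mult_inv_cancel:
  assumes "x \<in> carrier G" "y \<in> carrier G"
  shows "x \<otimes> (inv x \<otimes> y) = y" "inv x \<otimes> (x \<otimes> y) = y"
  using assms by (simp_all add: m_assoc[symmetric])

text \<open>\<open>cic\<close> is complete integral closedness: \<open>c\<close> acts as a common
  denominator of all powers of \<open>z\<close>.\<close>

locale normal_order = group Q for Q :: "('b, 'n) monoid_scheme" (structure) +
  fixes T :: "'b set"
  assumes submonoid: "submonoid T Q"
    and conj_closed: "x \<in> carrier Q \<Longrightarrow> t \<in> T \<Longrightarrow> x \<otimes> t \<otimes> inv x \<in> T"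
    and denominator: "q \<in> carrier Q \<Longrightarrow> \<exists>d \<in> T. d \<otimes> q \<in> T"
    and cic: "z \<in> carrier Q \<Longrightarrow> c \<in> carrier Q \<Longrightarrow> (\<And>n::nat. z [^] n \<otimes> c \<in> T) \<Longrightarrow> z \<in> T"
    and acc: "acc_divisorial Q T"
begin

lemma T_carrier [simp]: "t \<in> T \<Longrightarrow> t \<in> carrier Q"
  using submonoid.subset[OF submonoid] by auto

lemma T_mult [simp]: "s \<in> T \<Longrightarrow> t \<in> T \<Longrightarrow> s \<otimes> t \<in> T"
  by (rule submonoid.m_closed[OF submonoid])

lemma T_one [simp]: "\<one> \<in> T"
  by (rule submonoid.one_closed[OF submonoid])

lemma conj_closed': "x \<in> carrier Q \<Longrightarrow> t \<in> T \<Longrightarrow> inv x \<otimes> t \<otimes> x \<in> T"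
  using conj_closed[of "inv x" t] by simp

text \<open>\<open>y x\<close> is the conjugate of \<open>x y\<close> by \<open>inv x\<close>. For
  membership in \<open>T\<close> this replaces commutativity.\<close>

lemma mem_swap:
  assumes "x \<in> carrier Q" "y \<in> carrier Q"
  shows "x \<otimes> y \<in> T \<longleftrightarrow> y \<otimes> x \<in> T"
proof -
  have *: "y \<otimes> x \<in> T" if "x \<otimes> y \<in> T" "x \<in> carrier Q" "y \<in> carrier Q" for x y
    using conj_closed'[OF that(2) that(1)] that by (simp add: m_assoc mult_inv_cancel)
  show ?thesis using *[of x y] *[of y x] assms by blast
qed

section \<open>Duals and divisorial ideals\<close>

text \<open>The left quotient \<open>(T : Y)\<close>; by \<open>mem_swap\<close> it agrees with the
  right one when \<open>Y\<close> lies in \<open>Q\<close>.\<close>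

definition dual :: "'b set \<Rightarrow> 'b set" where
  "dual Y = {x \<in> carrier Q. \<forall>y \<in> Y. x \<otimes> y \<in> T}"

lemma dual_dual_dual:
  assumes "Y \<subseteq> carrier Q"
  shows "dual (dual (dual Y)) = dual Y"
proof
  show "dual (dual (dual Y)) \<subseteq> dual Y"
    unfolding dual_def using assms mem_swap by blast
  show "dual Y \<subseteq> dual (dual (dual Y))"
    unfolding dual_def using assms mem_swap by blast
qed

lemma dual_mult_left:
  assumes "t \<in> T" "x \<in> dual Y" "Y \<subseteq> carrier Q"
  shows "t \<otimes> x \<in> dual Y"
  using assms unfolding dual_def by (auto simp: m_assoc subset_iff)

lemma dual_mult_right:
  assumes t: "t \<in> T" and x: "x \<in> dual Y" and Y: "Y \<subseteq> carrier Q"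
  shows "x \<otimes> t \<in> dual Y"
proof -
  have xc: "x \<in> carrier Q" using x by (simp add: dual_def)
  have "(x \<otimes> t) \<otimes> y \<in> T" if y: "y \<in> Y" for y
  proof -
    have yc: "y \<in> carrier Q" using Y y by blast
    have "x \<otimes> y \<in> T" using x y by (simp add: dual_def)
    then have "y \<otimes> x \<in> T" using mem_swap xc yc by blast
    then have "y \<otimes> (x \<otimes> t) \<in> T" using t xc yc by (simp add: m_assoc[symmetric])
    then show ?thesis using mem_swap xc yc t by simp
  qed
  then show ?thesis using xc t by (simp add: dual_def)
qed

text \<open>If \<open>J q J\<close> lies in \<open>J\<close>, then every power of \<open>x q\<close>
  keeps a fixed \<open>y\<close> inside \<open>J\<close>, so \<open>y c\<close> is a common
  denominator of these powers and \<open>cic\<close> puts \<open>x q\<close> into \<open>T\<close>.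
  The converse is absorption of \<open>T\<close> from the left.\<close>

lemma ideal_inverse_eq_dual:
  assumes J: "J \<subseteq> carrier Q" "J \<noteq> {}" and left: "\<And>t x. t \<in> T \<Longrightarrow> x \<in> J \<Longrightarrow> t \<otimes> x \<in> J"
    and c: "c \<in> carrier Q" "\<And>x. x \<in> J \<Longrightarrow> x \<otimes> c \<in> T"
  shows "ideal_inverse Q J = dual J"
proof
  show "ideal_inverse Q J \<subseteq> dual J"
  proof
    fix q assume q: "q \<in> ideal_inverse Q J"
    then have qc: "q \<in> carrier Q" and qJ: "\<And>x y. x \<in> J \<Longrightarrow> y \<in> J \<Longrightarrow> x \<otimes> q \<otimes> y \<in> J"
      unfolding ideal_inverse_def r_coset_def set_mult_def by blast+
    obtain y where y: "y \<in> J" using J by blast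
    have "q \<otimes> x \<in> T" if x: "x \<in> J" for x
    proof -
      have xc: "x \<in> carrier Q" using x J by blast
      have pow: "(x \<otimes> q) [^] (n::nat) \<otimes> y \<in> J" for n
      proof (induction n)
        case 0
        then show ?case using y J by auto
      next
        case (Suc n)
        have "(x \<otimes> q) [^] Suc n \<otimes> y = x \<otimes> q \<otimes> ((x \<otimes> q) [^] n \<otimes> y)"
          using xc qc y J nat_pow_Suc2[of "x \<otimes> q" n] by (auto simp: m_assoc)
        then show ?case using qJ[OF x Suc] by simp
      qed
      have "(x \<otimes> q) [^] (n::nat) \<otimes> (y \<otimes> c) \<in> T" for n
        using c(2)[OF pow[of n]] xc qc y J c(1) by (auto simp: m_assoc)
      then have "x \<otimes> q \<in> T" using xc qc y J c(1) by (intro cic[of "x \<otimes> q" "y \<otimes> c"]) auto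
      then show ?thesis using mem_swap xc qc by blast
    qed
    then show "q \<in> dual J" using qc by (simp add: dual_def)
  qed
  show "dual J \<subseteq> ideal_inverse Q J"
  proof
    fix q assume q: "q \<in> dual J"
    then have "x \<otimes> q \<in> T" if "x \<in> J" for x
      using that J mem_swap[of q x] by (auto simp: dual_def)
    then show "q \<in> ideal_inverse Q J"
      using q left unfolding ideal_inverse_def r_coset_def set_mult_def dual_def by auto
  qed
qed

text \<open>Both inversions are duals, so the triple dual collapses. The bounding element is
  \<open>\<one>\<close> for \<open>dual Y\<close>, which lies in \<open>T\<close> because
  \<open>\<one>\<close> is in \<open>Y\<close>, and any member of \<open>dual Y\<close> for the
  bidual.\<close>

lemma dual_ideal:
  assumes Y: "Y \<subseteq> carrier Q" "\<one> \<in> Y" and ne: "dual Y \<noteq> {}"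
  shows "order_ideal Q T (dual Y)" "divisorial Q (dual Y)"
proof -
  have sub: "dual Y \<subseteq> T" using Y(2) by (auto simp: dual_def)
  show "order_ideal Q T (dual Y)"
    unfolding order_ideal_def fractional_ideal_def fractional_left_ideal_def
      fractional_right_ideal_def set_mult_def r_coset_def l_coset_def
    using ne sub dual_mult_left[OF _ _ Y(1)] dual_mult_right[OF _ _ Y(1)] by fastforce
  have "ideal_inverse Q (dual Y) = dual (dual Y)"
    using ne sub dual_mult_left[OF _ _ Y(1)] by (intro ideal_inverse_eq_dual[where c = \<one>]) auto
  moreover have "ideal_inverse Q (dual (dual Y)) = dual (dual (dual Y))"
  proof -
    obtain x where x: "x \<in> dual Y" using ne by blast
    show ?thesis
    proof (rule ideal_inverse_eq_dual)
      show "dual (dual Y) \<subseteq> carrier Q" by (auto simp: dual_def)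
      have "\<one> \<in> dual (dual Y)" using sub by (auto simp: dual_def)
      then show "dual (dual Y) \<noteq> {}" by blast
      show "t \<otimes> y \<in> dual (dual Y)" if "t \<in> T" "y \<in> dual (dual Y)" for t y
        using that sub by (intro dual_mult_left) auto
      show "x \<in> carrier Q" using x sub by auto
      show "y \<otimes> x \<in> T" if "y \<in> dual (dual Y)" for y
        using that x by (simp add: dual_def)
    qed
  qed
  ultimately show "divisorial Q (dual Y)"
    using dual_dual_dual[OF Y(1)] by (simp add: divisorial_def)
qed

text \<open>The ACC in the form needed twice: to find maximal ideals of denominators and to prove
  that supports are finite.\<close>

lemma exists_maximal_dual:
  assumes F: "\<And>X. X \<in> F \<Longrightarrow> \<exists>Y. Y \<subseteq> carrier Q \<and> \<one> \<in> Y \<and> dual Y \<noteq> {} \<and> X = dual Y"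
    and X0: "X0 \<in> F"
  shows "\<exists>X \<in> F. X0 \<subseteq> X \<and> (\<forall>X' \<in> F. X \<subseteq> X' \<longrightarrow> X' = X)"
proof (rule ccontr)
  assume no: "\<not> ?thesis"
  have "\<exists>I. \<forall>n::nat. (I n \<in> F \<and> X0 \<subseteq> I n) \<and> I n \<subset> I (Suc n)"
  proof (rule dependent_nat_choice)
    show "\<exists>X. X \<in> F \<and> X0 \<subseteq> X" using X0 by blast
    show "\<exists>X'. (X' \<in> F \<and> X0 \<subseteq> X') \<and> X \<subset> X'" if "X \<in> F \<and> X0 \<subseteq> X" for X and n :: nat
    proof -
      have "\<not> (\<forall>X' \<in> F. X \<subseteq> X' \<longrightarrow> X' = X)" using no that by simp
      then obtain X' where "X' \<in> F" "X \<subset> X'" by auto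
      then show ?thesis using that by (intro exI[of _ X']) auto
    qed
  qed
  then obtain I :: "nat \<Rightarrow> 'b set" where I: "\<And>n. I n \<in> F" "\<And>n. I n \<subset> I (Suc n)" by blast
  have "\<forall>n. order_ideal Q T (I n) \<and> divisorial Q (I n)"
    using F I(1) dual_ideal by metis
  then obtain n where "\<forall>m\<ge>n. I m = I n"
    using acc I(2) unfolding acc_divisorial_def by blast
  then show False using I(2)[of n] by (metis le_SucI order_refl psubset_eq)
qed

section \<open>Ideals of denominators and their maximal members\<close>

definition denominators :: "'b \<Rightarrow> 'b set" where
  "denominators q = {a \<in> T. a \<otimes> q \<in> T}"

lemma denominators_eq_dual: "denominators q = dual {\<one>, q}"
  by (auto simp: denominators_def dual_def)

lemma denominators_nonempty: "q \<in> carrier Q \<Longrightarrow> denominators q \<noteq> {}"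
  using denominator by (auto simp: denominators_def)

lemma denominatorsI: "a \<in> T \<Longrightarrow> a \<otimes> q \<in> T \<Longrightarrow> a \<in> denominators q"
  by (simp add: denominators_def)

lemma denominatorsD: "a \<in> denominators q \<Longrightarrow> a \<in> T" "a \<in> denominators q \<Longrightarrow> a \<otimes> q \<in> T"
  by (simp_all add: denominators_def)

lemma denominators_left: "q \<in> carrier Q \<Longrightarrow> a \<in> denominators q \<Longrightarrow> q \<otimes> a \<in> T"
  using mem_swap[of a q] by (simp add: denominators_def)

lemma denominators_mult:
  assumes "q \<in> carrier Q" "t \<in> T" "a \<in> denominators q"
  shows "t \<otimes> a \<in> denominators q" "a \<otimes> t \<in> denominators q"
  using assms dual_mult_left[of t a "{\<one>, q}"] dual_mult_right[of t a "{\<one>, q}"]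
  by (auto simp: denominators_eq_dual)

text \<open>In divisor-theoretic terms, an element of \<open>poles\<close> has pole order exactly one at a single height-one prime, namely
  \<open>denominators q\<close>, and no other pole.  Hence for \<open>a \<in> T\<close> the order of vanishing at that
  prime is the exponent at which \<open>a \<otimes> q [^] n\<close> first leaves it.\<close>

definition poles :: "'b set" where
  "poles = {q \<in> carrier Q - T. \<forall>r \<in> carrier Q - T.
     denominators q \<subseteq> denominators r \<longrightarrow> denominators r = denominators q}"

definition val :: "'b \<Rightarrow> 'b \<Rightarrow> nat" where
  "val q a = (LEAST n. a \<otimes> q [^] n \<notin> denominators q)"

text \<open>Whatever keeps \<open>r\<close> out of \<open>T\<close> is thus visible at a single
  maximal ideal of denominators, which is how divisibility is detected later.\<close>

lemma exists_pole:
  assumes "r \<in> carrier Q" "r \<notin> T"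
  shows "\<exists>q \<in> poles. denominators r \<subseteq> denominators q"
proof -
  have "\<exists>X \<in> denominators ` (carrier Q - T). denominators r \<subseteq> X \<and>
      (\<forall>X' \<in> denominators ` (carrier Q - T). X \<subseteq> X' \<longrightarrow> X' = X)"
  proof (rule exists_maximal_dual)
    fix X assume "X \<in> denominators ` (carrier Q - T)"
    then obtain q where "q \<in> carrier Q" "X = denominators q" by blast
    then show "\<exists>Y. Y \<subseteq> carrier Q \<and> \<one> \<in> Y \<and> dual Y \<noteq> {} \<and> X = dual Y"
      using denominators_nonempty by (intro exI[of _ "{\<one>, q}"]) (auto simp: denominators_eq_dual)
  qed (use assms in auto)
  then show ?thesis by (auto simp: poles_def)
qed

context
  fixes q assumes pole: "q \<in> poles"
begin

lemma pole_carrier [simp]: "q \<in> carrier Q" and pole_notin: "q \<notin> T"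
  using pole by (auto simp: poles_def)

text \<open>As \<open>y\<close> is no denominator of \<open>q\<close>, the element
  \<open>y q\<close> is still outside \<open>T\<close>. It has at least the denominators of
  \<open>q\<close>, hence by maximality the same ones, and \<open>x\<close> is among them.\<close>

lemma pole_prime:
  assumes x: "x \<in> T" and y: "y \<in> T" and xy: "x \<otimes> y \<in> denominators q"
    and ny: "y \<notin> denominators q"
  shows "x \<in> denominators q"
proof -
  have "denominators q \<subseteq> denominators (y \<otimes> q)"
  proof
    fix a assume a: "a \<in> denominators q"
    then have "a \<otimes> y \<in> denominators q" using denominators_mult y by simp
    then show "a \<in> denominators (y \<otimes> q)"
      using a y by (simp add: denominators_def m_assoc)
  qed
  moreover have "y \<otimes> q \<in> carrier Q - T" using y ny by (auto simp: denominators_def)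
  ultimately have "denominators (y \<otimes> q) = denominators q"
    using pole by (auto simp: poles_def)
  moreover have "x \<in> denominators (y \<otimes> q)"
    using x y xy by (simp add: denominators_def m_assoc)
  ultimately show ?thesis by simp
qed

text \<open>Otherwise multiplication by \<open>q\<close> maps its denominators into themselves, so
  all powers of \<open>q\<close> share a denominator and \<open>cic\<close> puts \<open>q\<close>
  into \<open>T\<close>.\<close>

lemma exists_uniformizer: "\<exists>p \<in> denominators q. q \<otimes> p \<notin> denominators q"
proof (rule ccontr)
  assume no: "\<not> ?thesis"
  obtain a where a: "a \<in> denominators q" using denominators_nonempty[of q] by auto
  have "q [^] (n::nat) \<otimes> a \<in> denominators q" for n
  proof (induction n)
    case 0
    then show ?case using a denominatorsD by simp
  next
    case (Suc n)
    have "q [^] Suc n \<otimes> a = q \<otimes> (q [^] n \<otimes> a)"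
      using a denominatorsD(1) nat_pow_Suc2[of q n] by (simp add: m_assoc)
    then show ?case using no Suc by simp
  qed
  then have "q \<in> T"
    using a denominatorsD(1) by (intro cic[of q a]) auto
  then show False using pole_notin by simp
qed

section \<open>Elements that normalize a prime\<close>

text \<open>The normalizer in \<open>Q\<close> of the prime \<open>denominators q\<close>.
  Conjugation preserves \<open>T\<close>, but a priori it may move one prime to another. Both
  directions are required because one inclusion alone need not be an equality.\<close>

definition stabilizer :: "'b set" where
  "stabilizer = {g \<in> carrier Q. \<forall>x \<in> denominators q.
     g \<otimes> x \<otimes> inv g \<in> denominators q \<and> inv g \<otimes> x \<otimes> g \<in> denominators q}"

lemma stabilizer_inv: "g \<in> stabilizer \<Longrightarrow> inv g \<in> stabilizer"
  by (simp add: stabilizer_def)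

lemma stabilizer_mult:
  assumes "g \<in> stabilizer" "h \<in> stabilizer"
  shows "g \<otimes> h \<in> stabilizer"
proof -
  have gh: "g \<in> carrier Q" "h \<in> carrier Q" using assms by (auto simp: stabilizer_def)
  have "g \<otimes> (h \<otimes> x \<otimes> inv h) \<otimes> inv g \<in> denominators q \<and>
      inv h \<otimes> (inv g \<otimes> x \<otimes> g) \<otimes> h \<in> denominators q" if "x \<in> denominators q" for x
    using that assms unfolding stabilizer_def by blast
  then show ?thesis
    using gh denominatorsD(1) by (auto simp: stabilizer_def m_assoc inv_mult_group)
qed

lemma stabilizer_pow: "g \<in> stabilizer \<Longrightarrow> g [^] (n::nat) \<in> stabilizer"
proof (induction n)
  case 0
  show ?case by (simp add: stabilizer_def denominatorsD)
next
  case (Suc n)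
  then show ?case using stabilizer_mult by simp
qed

lemma stabilizer_notin:
  assumes g: "g \<in> stabilizer" and x: "x \<in> T" "x \<notin> denominators q"
  shows "inv g \<otimes> x \<otimes> g \<notin> denominators q" "g \<otimes> x \<otimes> inv g \<notin> denominators q"
proof -
  have gc: "g \<in> carrier Q" using g by (simp add: stabilizer_def)
  have e: "g \<otimes> (inv g \<otimes> x \<otimes> g) \<otimes> inv g = x" "inv g \<otimes> (g \<otimes> x \<otimes> inv g) \<otimes> g = x"
    using gc x by (simp_all add: m_assoc mult_inv_cancel)
  show "inv g \<otimes> x \<otimes> g \<notin> denominators q" "g \<otimes> x \<otimes> inv g \<notin> denominators q"
    using g x e unfolding stabilizer_def by force+
qed

text \<open>Writing \<open>x'\<close> for a conjugate of \<open>x\<close>, either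
  \<open>x' a = a x\<close> or \<open>a x' = x a\<close> lies in the prime; as \<open>a\<close> does
  not, primality gives \<open>x'\<close>.\<close>

lemma stabilizer_outside:
  assumes a: "a \<in> T" "a \<notin> denominators q"
  shows "a \<in> stabilizer"
proof -
  have "a \<otimes> x \<otimes> inv a \<in> denominators q \<and> inv a \<otimes> x \<otimes> a \<in> denominators q"
    if x: "x \<in> denominators q" for x
  proof
    have xT: "x \<in> T" using x denominatorsD by simp
    have "(a \<otimes> x \<otimes> inv a) \<otimes> a \<in> denominators q"
      using x xT a denominators_mult by (simp add: m_assoc)
    then show "a \<otimes> x \<otimes> inv a \<in> denominators q"
      using a xT conj_closed[of a x] pole_prime[of "a \<otimes> x \<otimes> inv a" a] by simp
    have e: "a \<otimes> (inv a \<otimes> x \<otimes> a) = x \<otimes> a" using a xT by (simp add: m_assoc mult_inv_cancel)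
    show "inv a \<otimes> x \<otimes> a \<in> denominators q"
    proof (rule ccontr)
      assume "inv a \<otimes> x \<otimes> a \<notin> denominators q"
      then have "a \<in> denominators q"
        using pole_prime[of a "inv a \<otimes> x \<otimes> a"] e a xT x conj_closed'[of a x] denominators_mult
        by simp
      then show False using a by simp
    qed
  qed
  then show ?thesis using a by (simp add: stabilizer_def)
qed

text \<open>Here \<open>p\<close> is in the prime and cannot be cancelled by primality, so
  \<open>q p\<close> and \<open>p q\<close>, which lie outside it, take its place:
  \<open>(q p)(inv p x p) = (q x) p\<close> and \<open>(p x inv p)(p q) = p (x q)\<close>.\<close>

lemma uniformizer_stabilizer:
  assumes p: "p \<in> denominators q" "q \<otimes> p \<notin> denominators q"
  shows "p \<in> stabilizer"
proof -
  have pT: "p \<in> T" using p denominatorsD by simp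
  have qp: "q \<otimes> p \<in> T" and pq: "p \<otimes> q \<in> T" using p denominators_left denominatorsD by auto
  have 1: "inv p \<otimes> x \<otimes> p \<in> denominators q" if x: "x \<in> denominators q" for x
  proof (rule ccontr)
    assume n: "inv p \<otimes> x \<otimes> p \<notin> denominators q"
    have xT: "x \<in> T" using x denominatorsD by simp
    have "(q \<otimes> p) \<otimes> (inv p \<otimes> x \<otimes> p) = (q \<otimes> x) \<otimes> p"
      using pT xT by (simp add: m_assoc mult_inv_cancel)
    moreover have "(q \<otimes> x) \<otimes> p \<in> denominators q"
      using denominators_mult p x denominators_left by simp
    ultimately show False
      using n p qp pole_prime[of "q \<otimes> p" "inv p \<otimes> x \<otimes> p"] conj_closed'[of p x] pT xT by simp
  qed
  \<comment> \<open>Conjugating \<open>p q\<close> by \<open>inv p\<close> gives \<open>q p\<close>,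
    so the direction already proved transfers the non-membership.\<close>
  have pqn: "p \<otimes> q \<notin> denominators q"
  proof
    assume "p \<otimes> q \<in> denominators q"
    then have "inv p \<otimes> (p \<otimes> q) \<otimes> p \<in> denominators q" by (rule 1)
    then show False using p pT by (simp add: m_assoc[symmetric])
  qed
  have 2: "p \<otimes> x \<otimes> inv p \<in> denominators q" if x: "x \<in> denominators q" for x
  proof -
    have xT: "x \<in> T" using x denominatorsD by simp
    have "(p \<otimes> x \<otimes> inv p) \<otimes> (p \<otimes> q) = p \<otimes> (x \<otimes> q)"
      using pT xT by (simp add: m_assoc mult_inv_cancel)
    moreover have "p \<otimes> (x \<otimes> q) \<in> denominators q"
      using denominators_mult p x denominatorsD by simp
    ultimately show ?thesis
      using pqn pq pole_prime[of "p \<otimes> x \<otimes> inv p" "p \<otimes> q"] conj_closed[of p x] pT xT by simp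
  qed
  show ?thesis using 1 2 pT by (simp add: stabilizer_def)
qed

text \<open>\<open>q\<close> is \<open>q p\<close>, which lies outside the prime, times the inverse
  of the uniformizer \<open>p\<close>; both factors normalize the prime.\<close>

lemma pole_stabilizer: "q \<in> stabilizer"
proof -
  obtain p where p: "p \<in> denominators q" "q \<otimes> p \<notin> denominators q"
    using exists_uniformizer by blast
  have pT: "p \<in> T" using p denominatorsD by simp
  have "(q \<otimes> p) \<otimes> inv p \<in> stabilizer"
    using p by (intro stabilizer_mult stabilizer_outside stabilizer_inv uniformizer_stabilizer)
      (auto intro: denominators_left)
  then show ?thesis using pT by (simp add: m_assoc)
qed

text \<open>Multiplying by a uniformizer \<open>p\<close> on the right lowers the power of
  \<open>q\<close> by one and turns \<open>u\<close> into \<open>u s'\<close>, where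
  \<open>s'\<close> is a conjugate of \<open>q p\<close>. As \<open>s'\<close> is outside the prime,
  so is \<open>u s'\<close>, and induction applies.\<close>

lemma outside_mult_pow_notin:
  assumes "u \<in> T" "u \<notin> denominators q"
  shows "u \<otimes> q [^] Suc j \<notin> T"
  using assms
proof (induction j arbitrary: u)
  case 0
  then show ?case by (simp add: denominators_def)
next
  case (Suc j)
  obtain p where p: "p \<in> denominators q" "q \<otimes> p \<notin> denominators q"
    using exists_uniformizer by blast
  have pT: "p \<in> T" using p denominatorsD by simp
  have sT: "q \<otimes> p \<in> T" using p denominators_left by simp
  define Z where "Z = q [^] Suc j"
  have Z: "Z \<in> stabilizer" "Z \<in> carrier Q"
    using stabilizer_pow[OF pole_stabilizer, of "Suc j"] by (auto simp: Z_def)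
  define s' where "s' = Z \<otimes> (q \<otimes> p) \<otimes> inv Z"
  have s': "s' \<in> T" "s' \<notin> denominators q"
    using stabilizer_notin(2)[OF Z(1) sT p(2)] conj_closed[OF Z(2) sT] by (auto simp: s'_def)
  have "u \<otimes> s' \<notin> denominators q" using pole_prime[of u s'] s' Suc.prems by blast
  then have "(u \<otimes> s') \<otimes> Z \<notin> T" using Suc.IH[of "u \<otimes> s'"] s' Suc.prems by (simp add: Z_def)
  moreover have "(u \<otimes> s') \<otimes> Z = (u \<otimes> q [^] Suc (Suc j)) \<otimes> p"
  proof -
    have "(u \<otimes> s') \<otimes> Z = u \<otimes> (Z \<otimes> (q \<otimes> p))"
      using Z Suc.prems pT by (simp add: s'_def m_assoc)
    also have "\<dots> = (u \<otimes> q [^] Suc (Suc j)) \<otimes> p"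
      using Z Suc.prems pT by (simp add: Z_def m_assoc)
    finally show ?thesis .
  qed
  ultimately show ?case using pT T_mult by metis
qed

section \<open>Additivity of the valuation at a pole\<close>

lemma val_below: "n < val q a \<Longrightarrow> a \<otimes> q [^] n \<in> denominators q"
  using not_less_Least[of n "\<lambda>n. a \<otimes> q [^] n \<notin> denominators q"] by (auto simp: val_def)

text \<open>The minimum defining \<open>val\<close> is attained: otherwise \<open>a\<close> would be
  a common denominator of all powers of \<open>q\<close>.\<close>

lemma val_notin:
  assumes "a \<in> T"
  shows "a \<otimes> q [^] val q a \<notin> denominators q"
proof -
  have "\<exists>n. a \<otimes> q [^] (n::nat) \<notin> denominators q"
  proof (rule ccontr)
    assume "\<not> ?thesis"
    then have "q [^] (n::nat) \<otimes> a \<in> T" for n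
      using denominatorsD(1) mem_swap[of a "q [^] n"] assms by auto
    then show False using cic[of q a] assms pole_notin by simp
  qed
  then show ?thesis unfolding val_def by (rule LeastI_ex)
qed

lemma val_le_mem:
  assumes "a \<in> T" "n \<le> val q a"
  shows "a \<otimes> q [^] n \<in> T"
proof (cases n)
  case 0
  then show ?thesis using assms by simp
next
  case (Suc m)
  then show ?thesis
    using assms denominatorsD(2)[OF val_below[of m a]] by (simp add: m_assoc)
qed

text \<open>The least exponent is at most \<open>n\<close>; beyond it the product leaves
  \<open>T\<close> altogether, so membership in \<open>T\<close> excludes a larger
  \<open>n\<close>.\<close>

lemma val_eqI:
  assumes a: "a \<in> T" and n: "a \<otimes> q [^] n \<in> T" "a \<otimes> q [^] n \<notin> denominators q"
  shows "val q a = n"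
proof (rule ccontr)
  assume ne: "val q a \<noteq> n"
  have "val q a \<le> n" unfolding val_def using n(2) by (rule Least_le)
  then obtain j where j: "n = val q a + Suc j" using ne by (metis less_imp_Suc_add add_Suc_right le_neq_implies_less)
  have "(a \<otimes> q [^] val q a) \<otimes> q [^] Suc j \<notin> T"
    using a by (intro outside_mult_pow_notin val_notin val_le_mem) auto
  moreover have "(a \<otimes> q [^] val q a) \<otimes> q [^] Suc j = a \<otimes> q [^] n"
    using a unfolding j by (simp only: nat_pow_mult[symmetric] m_assoc T_carrier nat_pow_closed pole_carrier)
  ultimately show False using n by simp
qed

text \<open>The power of \<open>q\<close> belonging to \<open>b\<close> is absorbed first and
  carries \<open>b\<close> outside the prime. Moving the power belonging to \<open>a\<close> across
  the result conjugates it, and it stays outside because \<open>q\<close> normalizes the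
  prime.\<close>

lemma val_mult:
  assumes a: "a \<in> T" and b: "b \<in> T"
  shows "val q (a \<otimes> b) = val q a + val q b"
proof (rule val_eqI)
  define n where "n = val q a"
  define m where "m = val q b"
  define t where "t = a \<otimes> q [^] n"
  define u where "u = b \<otimes> q [^] m"
  have t: "t \<in> T" "t \<notin> denominators q" and u: "u \<in> T" "u \<notin> denominators q"
    using a b val_notin val_le_mem by (auto simp: t_def u_def n_def m_def)
  define Z where "Z = q [^] n"
  have Z: "Z \<in> stabilizer" "Z \<in> carrier Q"
    using stabilizer_pow[OF pole_stabilizer] by (auto simp: Z_def)
  define u' where "u' = inv Z \<otimes> u \<otimes> Z"
  have u': "u' \<in> T" "u' \<notin> denominators q"
    using stabilizer_notin(1)[OF Z(1) u] conj_closed'[OF Z(2) u(1)] by (auto simp: u'_def)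
  have "q [^] (n + m) = q [^] m \<otimes> Z"
    by (simp add: Z_def nat_pow_mult add.commute)
  then have "(a \<otimes> b) \<otimes> q [^] (n + m) = a \<otimes> (u \<otimes> Z)"
    using a b Z by (simp add: u_def m_assoc)
  also have "\<dots> = a \<otimes> (Z \<otimes> u')"
    using u Z by (simp add: u'_def m_assoc mult_inv_cancel)
  also have "\<dots> = t \<otimes> u'"
    using a u' Z by (simp add: t_def Z_def m_assoc)
  finally have e: "(a \<otimes> b) \<otimes> q [^] (n + m) = t \<otimes> u'" .
  show "a \<otimes> b \<otimes> q [^] (val q a + val q b) \<in> T"
    using e t u' by (simp add: n_def m_def)
  show "a \<otimes> b \<otimes> q [^] (val q a + val q b) \<notin> denominators q"
    using e t u' pole_prime[of t u'] by (auto simp: n_def m_def)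
qed (use a b in simp)

lemma val_pos_iff:
  assumes "a \<in> T"
  shows "0 < val q a \<longleftrightarrow> a \<in> denominators q"
  using assms val_below[of 0 a] val_notin[of a] by (cases "val q a") auto

text \<open>Otherwise \<open>a\<close> times the power \<open>Z\<close> of \<open>q\<close> lies
  outside the prime, while \<open>(b inv a)(a Z) = b Z\<close> is in \<open>T\<close>; so
  \<open>a Z\<close> is a denominator of \<open>b inv a\<close>.\<close>

lemma val_less:
  assumes a: "a \<in> T" and b: "b \<in> T" and r: "denominators (b \<otimes> inv a) \<subseteq> denominators q"
  shows "val q b < val q a"
proof (rule ccontr)
  assume le: "\<not> val q b < val q a"
  define Z where "Z = q [^] val q a"
  have Z: "Z \<in> carrier Q" by (simp add: Z_def)
  have t: "a \<otimes> Z \<in> T" "a \<otimes> Z \<notin> denominators q" and u: "b \<otimes> Z \<in> T"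
    using a b le val_notin val_le_mem by (auto simp: Z_def)
  have "(b \<otimes> inv a) \<otimes> (a \<otimes> Z) = b \<otimes> (inv a \<otimes> a) \<otimes> Z"
    using a b Z by (simp only: m_assoc T_carrier inv_closed m_closed)
  also have "\<dots> = b \<otimes> Z" using a b by simp
  finally have "(a \<otimes> Z) \<otimes> (b \<otimes> inv a) \<in> T"
    using u a b Z mem_swap[of "b \<otimes> inv a" "a \<otimes> Z"] by simp
  then show False using t r by (auto simp: denominators_def)
qed

end

section \<open>Finite supports\<close>

text \<open>By maximality distinct primes are incomparable, so each member of \<open>F\<close>
  contains some \<open>z\<close> outside \<open>denominators q\<close>; primality keeps the product
  of these outside.\<close>

lemma prime_avoidance:
  assumes q: "q \<in> poles" and "finite F" "F \<subseteq> denominators ` poles" "denominators q \<notin> F"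
  shows "\<exists>y \<in> T. y \<notin> denominators q \<and> (\<forall>N \<in> F. y \<in> N)"
  using assms(2-)
proof (induction F)
  case empty
  have "\<one> \<notin> denominators q"
    using pole_notin[OF q] pole_carrier[OF q] by (simp add: denominators_def)
  then show ?case by (intro bexI[of _ \<one>]) auto
next
  case (insert N F)
  then obtain y where y: "y \<in> T" "y \<notin> denominators q" "\<forall>N \<in> F. y \<in> N" by auto
  obtain r where r: "r \<in> poles" "N = denominators r" using insert.prems by blast
  then have "\<not> denominators r \<subseteq> denominators q"
    using q insert.prems unfolding poles_def by blast
  then obtain z where z: "z \<in> denominators r" "z \<notin> denominators q" by blast
  have zT: "z \<in> T" using z denominatorsD by simp
  have "y \<otimes> z \<in> M" if M: "M \<in> insert N F" for M
  proof -
    obtain m where "m \<in> poles" "M = denominators m" using M insert.prems by blast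
    moreover have "y \<in> M \<or> z \<in> M" using M y z r by auto
    ultimately show ?thesis
      using denominators_mult[of m y z] denominators_mult[of m z y] y zT pole_carrier by auto
  qed
  then show ?case
    using y z zT pole_prime[OF q, of y z] by (intro bexI[of _ "y \<otimes> z"]) auto
qed

lemma finite_denominators:
  assumes a: "a \<in> T"
  shows "finite {M \<in> denominators ` poles. a \<in> M}" (is "finite ?D")
proof -
  \<comment> \<open>Descending chains of intersections of primes containing \<open>a\<close> become ascending after
    dualizing; \<open>I F\<close> is the inverse of \<open>\<Inter>F\<close>, scaled by \<open>a\<close> into \<open>T\<close>.\<close>
  define Y where "Y F = insert \<one> {y \<otimes> inv a | y. y \<in> T \<and> (\<forall>N \<in> F. y \<in> N)}" for F :: "'b set set"
  define I where "I F = dual (Y F)" for F :: "'b set set"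
  have Yc: "Y F \<subseteq> carrier Q" for F using a by (auto simp: Y_def)
  have aI: "a \<in> I F" for F
    using a conj_closed[of a] by (auto simp: I_def dual_def Y_def m_assoc)
  let ?G = "{F. finite F \<and> F \<subseteq> ?D}"
  have "\<exists>X \<in> I ` ?G. I {} \<subseteq> X \<and>
      (\<forall>X' \<in> I ` ?G. X \<subseteq> X' \<longrightarrow> X' = X)"
  proof (rule exists_maximal_dual)
    fix X assume "X \<in> I ` ?G"
    then obtain F where "X = I F" by blast
    then show "\<exists>Y. Y \<subseteq> carrier Q \<and> \<one> \<in> Y \<and> dual Y \<noteq> {} \<and> X = dual Y"
      using Yc aI[of F] unfolding I_def by (intro exI[of _ "Y F"]) (auto simp: Y_def)
  qed auto
  then obtain X where X: "X \<in> I ` ?G" "\<forall>X' \<in> I ` ?G. X \<subseteq> X' \<longrightarrow> X' = X"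
    by (elim bexE conjE)
  then obtain F where F: "finite F" "F \<subseteq> ?D" "X = I F" by auto
  have max: "I F' = I F" if "finite F'" "F' \<subseteq> ?D" "I F \<subseteq> I F'" for F'
    using X(2) F(3) that by simp
  have "?D \<subseteq> F"
  proof (rule ccontr)
    assume "\<not> ?D \<subseteq> F"
    then obtain q where q: "q \<in> poles" "a \<in> denominators q" "denominators q \<notin> F" by blast
    have qc: "q \<in> carrier Q" by (rule pole_carrier[OF q(1)])
    have "Y (insert (denominators q) F) \<subseteq> Y F" by (auto simp: Y_def)
    then have "I F \<subseteq> I (insert (denominators q) F)" by (auto simp: I_def dual_def)
    then have eq: "I (insert (denominators q) F) = I F" using F q by (intro max) auto
    have key: "a \<otimes> q \<otimes> (y \<otimes> inv a) \<in> T \<longleftrightarrow> y \<in> denominators q" if y: "y \<in> T" for y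
    proof -
      have "(y \<otimes> inv a) \<otimes> (a \<otimes> q) = y \<otimes> q"
        using a qc y by (simp add: m_assoc mult_inv_cancel)
      then show ?thesis
        using mem_swap[of "a \<otimes> q" "y \<otimes> inv a"] a y qc by (simp add: denominators_def)
    qed
    \<comment> \<open>The element \<open>a q\<close> separates the two duals: membership in
      \<open>I F\<close> would force everything common to the primes in \<open>F\<close> into
      \<open>denominators q\<close>, against prime avoidance.\<close>
    have "a \<otimes> q \<in> I (insert (denominators q) F)"
      using key a qc denominatorsD(2)[OF q(2)] by (auto simp: I_def dual_def Y_def)
    then have "a \<otimes> q \<in> I F" using eq by simp
    then have "y \<in> denominators q" if "y \<in> T" "\<forall>N \<in> F. y \<in> N" for y
      using that key[of y] by (auto simp: I_def dual_def Y_def)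
    then show False using prime_avoidance[OF q(1) F(1) _ q(3)] F(2) by blast
  qed
  then show ?thesis using F(1) finite_subset by blast
qed

text \<open>Different poles may have the same denominators, hence the same valuation; choosing
  representatives keeps supports finite.\<close>

lemma exists_valuations:
  "\<exists>R \<subseteq> poles.
     (\<forall>a \<in> T. finite {q \<in> R. 0 < val q a}) \<and>
     (\<forall>a \<in> T. \<forall>b \<in> T. (\<forall>q \<in> R. val q a \<le> val q b) \<longrightarrow> b \<otimes> inv a \<in> T)"
proof -
  obtain R where R: "R \<subseteq> poles" "inj_on denominators R"
    "denominators ` poles = denominators ` R"
    using subset_image_inj[of "denominators ` poles" denominators poles] by auto
  have "finite {q \<in> R. 0 < val q a}" if a: "a \<in> T" for a
  proof (rule finite_imageD)
    show "inj_on denominators {q \<in> R. 0 < val q a}" using R(2) by (rule inj_on_subset) auto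
    have "denominators ` {q \<in> R. 0 < val q a} \<subseteq> {M \<in> denominators ` poles. a \<in> M}"
      using R(1) val_pos_iff a by auto
    then show "finite (denominators ` {q \<in> R. 0 < val q a})"
      using finite_denominators[OF a] finite_subset by blast
  qed
  moreover have "b \<otimes> inv a \<in> T"
    if a: "a \<in> T" and b: "b \<in> T" and le: "\<forall>q \<in> R. val q a \<le> val q b" for a b
  proof (rule ccontr)
    assume "b \<otimes> inv a \<notin> T"
    then obtain q where "q \<in> poles" "denominators (b \<otimes> inv a) \<subseteq> denominators q"
      using exists_pole[of "b \<otimes> inv a"] a b by auto
    then obtain q' where q': "q' \<in> R" "denominators (b \<otimes> inv a) \<subseteq> denominators q'"
      using R(3) by (metis imageE imageI)
    then have "val q' b < val q' a" using R(1) val_less a b by blast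
    then show False using le q'(1) by force
  qed
  ultimately show ?thesis using R(1) by (intro exI[of _ R]) auto
qed

end

section \<open>Normalizing Krull monoids\<close>

text \<open>For \<open>x = a inv c\<close>, conjugation by \<open>x\<close> is conjugation by
  \<open>inv c\<close> followed by conjugation by \<open>a\<close>; the two inclusions of the coset
  equality handle one each.\<close>

lemma normal_conj_closed:
  assumes "group Q" and ord: "order_in Q T"
    and norm: "\<And>a. a \<in> T \<Longrightarrow> a <#\<^bsub>Q\<^esub> T = T #>\<^bsub>Q\<^esub> a"
    and x: "x \<in> carrier Q" and t: "t \<in> T"
  shows "x \<otimes>\<^bsub>Q\<^esub> t \<otimes>\<^bsub>Q\<^esub> inv\<^bsub>Q\<^esub> x \<in> T"
proof -
  interpret group Q by fact
  have Tc: "T \<subseteq> carrier Q" using ord by (auto simp: order_in_def dest: submonoid.subset)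
  have pos: "a \<otimes>\<^bsub>Q\<^esub> s \<otimes>\<^bsub>Q\<^esub> inv\<^bsub>Q\<^esub> a \<in> T" if a: "a \<in> T" and s: "s \<in> T" for a s
  proof -
    have "a \<otimes>\<^bsub>Q\<^esub> s \<in> a <#\<^bsub>Q\<^esub> T" using s by (auto simp: l_coset_def)
    then have "a \<otimes>\<^bsub>Q\<^esub> s \<in> T #>\<^bsub>Q\<^esub> a" using norm[OF a] by simp
    then obtain s' where s': "s' \<in> T" "a \<otimes>\<^bsub>Q\<^esub> s = s' \<otimes>\<^bsub>Q\<^esub> a" by (auto simp: r_coset_def)
    then have "a \<otimes>\<^bsub>Q\<^esub> s \<otimes>\<^bsub>Q\<^esub> inv\<^bsub>Q\<^esub> a = s'" using a Tc by (auto simp: m_assoc subset_iff)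
    then show ?thesis using s' by simp
  qed
  have neg: "inv\<^bsub>Q\<^esub> a \<otimes>\<^bsub>Q\<^esub> s \<otimes>\<^bsub>Q\<^esub> a \<in> T" if a: "a \<in> T" and s: "s \<in> T" for a s
  proof -
    have "s \<otimes>\<^bsub>Q\<^esub> a \<in> T #>\<^bsub>Q\<^esub> a" using s by (auto simp: r_coset_def)
    then have "s \<otimes>\<^bsub>Q\<^esub> a \<in> a <#\<^bsub>Q\<^esub> T" using norm[OF a] by simp
    then obtain s' where s': "s' \<in> T" "s \<otimes>\<^bsub>Q\<^esub> a = a \<otimes>\<^bsub>Q\<^esub> s'" by (auto simp: l_coset_def)
    then have "inv\<^bsub>Q\<^esub> a \<otimes>\<^bsub>Q\<^esub> s \<otimes>\<^bsub>Q\<^esub> a = s'"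
      using a s Tc by (simp add: m_assoc mult_inv_cancel subset_iff)
    then show ?thesis using s' by simp
  qed
  obtain a c where ac: "a \<in> T" "c \<in> T" "x = a \<otimes>\<^bsub>Q\<^esub> inv\<^bsub>Q\<^esub> c"
    using ord x unfolding order_in_def by blast
  have "x \<otimes>\<^bsub>Q\<^esub> t \<otimes>\<^bsub>Q\<^esub> inv\<^bsub>Q\<^esub> x = a \<otimes>\<^bsub>Q\<^esub> (inv\<^bsub>Q\<^esub> c \<otimes>\<^bsub>Q\<^esub> t \<otimes>\<^bsub>Q\<^esub> c) \<otimes>\<^bsub>Q\<^esub> inv\<^bsub>Q\<^esub> a"
    using ac t Tc by (simp add: m_assoc inv_mult_group subset_iff)
  then show ?thesis using pos neg ac t by simp
qed

text \<open>Let \<open>I\<close> be the union of the sets \<open>z^n T\<close>. Its left multipliers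
  \<open>T'\<close> form an order above \<open>T\<close>, and \<open>T'\<close> lies in
  \<open>I\<close> since \<open>\<one>\<close> does, so \<open>c\<close> carries it into
  \<open>T\<close>. The orders are thus equivalent, maximality gives \<open>T' = T\<close>, and
  \<open>z\<close> is a multiplier.\<close>

lemma maximal_order_completely_integrally_closed:
  assumes "group Q" and max: "maximal_order Q T"
    and conj: "\<And>x t. x \<in> carrier Q \<Longrightarrow> t \<in> T \<Longrightarrow> x \<otimes>\<^bsub>Q\<^esub> t \<otimes>\<^bsub>Q\<^esub> inv\<^bsub>Q\<^esub> x \<in> T"
    and z: "z \<in> carrier Q" and c: "c \<in> carrier Q" and zc: "\<And>n::nat. z [^]\<^bsub>Q\<^esub> n \<otimes>\<^bsub>Q\<^esub> c \<in> T"
  shows "z \<in> T"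
proof -
  interpret group Q by fact
  have ord: "order_in Q T" using max by (simp add: maximal_order_def)
  then have sm: "submonoid T Q" by (simp add: order_in_def)
  note Tc = submonoid.subset[OF sm] and T1 = submonoid.one_closed[OF sm]
    and Tm = submonoid.m_closed[OF sm]
  define I where "I = {z [^]\<^bsub>Q\<^esub> n \<otimes>\<^bsub>Q\<^esub> t | (n::nat) t. t \<in> T}"
  define T' where "T' = {x \<in> carrier Q. \<forall>y \<in> I. x \<otimes>\<^bsub>Q\<^esub> y \<in> I}"
  have Ic: "I \<subseteq> carrier Q" using z Tc by (auto simp: I_def)
  have "z [^]\<^bsub>Q\<^esub> (0::nat) \<otimes>\<^bsub>Q\<^esub> \<one>\<^bsub>Q\<^esub> \<in> I" unfolding I_def using T1 by blast
  then have I1: "\<one>\<^bsub>Q\<^esub> \<in> I" by simp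
  have Ibd: "y \<otimes>\<^bsub>Q\<^esub> c \<in> T" if "y \<in> I" for y
  proof -
    obtain n :: nat and t where t: "y = z [^]\<^bsub>Q\<^esub> n \<otimes>\<^bsub>Q\<^esub> t" "t \<in> T" using \<open>y \<in> I\<close> by (auto simp: I_def)
    have "y \<otimes>\<^bsub>Q\<^esub> c = (z [^]\<^bsub>Q\<^esub> n \<otimes>\<^bsub>Q\<^esub> c) \<otimes>\<^bsub>Q\<^esub> (inv\<^bsub>Q\<^esub> c \<otimes>\<^bsub>Q\<^esub> t \<otimes>\<^bsub>Q\<^esub> c)"
      using t z c Tc by (simp add: m_assoc mult_inv_cancel subset_iff)
    moreover have "inv\<^bsub>Q\<^esub> c \<otimes>\<^bsub>Q\<^esub> t \<otimes>\<^bsub>Q\<^esub> c \<in> T" using conj[of "inv\<^bsub>Q\<^esub> c" t] c t by simp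
    ultimately show ?thesis using Tm zc by simp
  qed
  have left: "s \<otimes>\<^bsub>Q\<^esub> y \<in> I" if "s \<in> T" "y \<in> I" for s y
  proof -
    obtain n :: nat and t where t: "y = z [^]\<^bsub>Q\<^esub> n \<otimes>\<^bsub>Q\<^esub> t" "t \<in> T" using \<open>y \<in> I\<close> by (auto simp: I_def)
    define Z where "Z = z [^]\<^bsub>Q\<^esub> n"
    have Z: "Z \<in> carrier Q" using z by (simp add: Z_def)
    have "s \<otimes>\<^bsub>Q\<^esub> y = Z \<otimes>\<^bsub>Q\<^esub> ((inv\<^bsub>Q\<^esub> Z \<otimes>\<^bsub>Q\<^esub> s \<otimes>\<^bsub>Q\<^esub> Z) \<otimes>\<^bsub>Q\<^esub> t)"
      using t Z that Tc unfolding Z_def[symmetric] by (simp add: m_assoc mult_inv_cancel subset_iff)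
    moreover have "inv\<^bsub>Q\<^esub> Z \<otimes>\<^bsub>Q\<^esub> s \<otimes>\<^bsub>Q\<^esub> Z \<in> T" using conj[of "inv\<^bsub>Q\<^esub> Z" s] Z that by simp
    ultimately show ?thesis unfolding I_def Z_def using Tm t by blast
  qed
  have TT': "T \<subseteq> T'" using left Tc by (auto simp: T'_def)
  have T'I: "T' \<subseteq> I" using I1 by (force simp: T'_def)
  have "submonoid T' Q"
    using Ic by unfold_locales (auto simp: T'_def m_assoc subset_iff)
  then have "order_in Q T'"
    using ord TT' unfolding order_in_def by blast
  moreover have "equivalent_orders Q T T'"
    unfolding equivalent_orders_def
  proof (intro bexI conjI)
    show "\<one>\<^bsub>Q\<^esub> <#\<^bsub>Q\<^esub> T #>\<^bsub>Q\<^esub> \<one>\<^bsub>Q\<^esub> \<subseteq> T'" using TT' Tc by (auto simp: l_coset_def r_coset_def subset_iff)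
    show "\<one>\<^bsub>Q\<^esub> <#\<^bsub>Q\<^esub> T' #>\<^bsub>Q\<^esub> c \<subseteq> T"
      using T'I Ic Ibd by (auto simp: l_coset_def r_coset_def subset_iff)
  qed (use c in auto)
  ultimately have "T' = T" using max TT' by (auto simp: maximal_order_def)
  moreover have "z \<in> T'"
  proof -
    have "z \<otimes>\<^bsub>Q\<^esub> y \<in> I" if "y \<in> I" for y
    proof -
      obtain n :: nat and t where t: "y = z [^]\<^bsub>Q\<^esub> n \<otimes>\<^bsub>Q\<^esub> t" "t \<in> T" using \<open>y \<in> I\<close> by (auto simp: I_def)
      then have "z \<otimes>\<^bsub>Q\<^esub> y = z [^]\<^bsub>Q\<^esub> Suc n \<otimes>\<^bsub>Q\<^esub> t"
        using z Tc nat_pow_Suc2[OF z, of n] by (auto simp: m_assoc simp del: nat_pow_Suc)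
      then show ?thesis unfolding I_def using t by blast
    qed
    then show ?thesis using z by (simp add: T'_def)
  qed
  ultimately show ?thesis by simp
qed

theorem proposition6p16:
  fixes S :: "('a, 'm) monoid_scheme" and Q :: "('b, 'n) monoid_scheme" and \<iota> :: "'a \<Rightarrow> 'b"
  assumes "krull_monoid S Q \<iota>" and "normalizing S"
  shows "\<forall>a \<in> carrier S. omega_p_sup S a < \<infinity> \<and> omega_p'_sup S a < \<infinity>"
proof -
  interpret S: monoid_cancel S using assms(1) by (simp add: krull_monoid_def)
  interpret Q: group Q using assms(1) by (simp add: krull_monoid_def quotient_group_def)
  define T where "T = \<iota> ` carrier S"
  have hom: "\<iota> \<in> hom S Q" and inj: "inj_on \<iota> (carrier S)" and ord: "order_in Q T"
    and max: "maximal_order Q T" and acc: "acc_divisorial Q T"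
    using assms(1) by (auto simp: krull_monoid_def quotient_group_def T_def)
  have norm: "a <#\<^bsub>Q\<^esub> T = T #>\<^bsub>Q\<^esub> a" if "a \<in> T" for a
  proof -
    obtain s where s: "s \<in> carrier S" "a = \<iota> s" using \<open>a \<in> T\<close> by (auto simp: T_def)
    have "a <#\<^bsub>Q\<^esub> T = \<iota> ` (s <#\<^bsub>S\<^esub> carrier S)"
      using s hom by (simp add: l_coset_def T_def hom_mult image_UN)
    also have "\<dots> = \<iota> ` (carrier S #>\<^bsub>S\<^esub> s)" using assms(2) s by (simp add: normalizing_def)
    also have "\<dots> = T #>\<^bsub>Q\<^esub> a" using s hom by (simp add: r_coset_def T_def hom_mult image_UN)
    finally show ?thesis .
  qed
  note conj = normal_conj_closed[OF Q.is_group ord norm]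
  interpret normal_order Q T
  proof (intro normal_order.intro normal_order_axioms.intro)
    show "group Q" by (rule Q.is_group)
    show "submonoid T Q" using ord by (simp add: order_in_def)
    show "\<exists>d \<in> T. d \<otimes>\<^bsub>Q\<^esub> q \<in> T" if q: "q \<in> carrier Q" for q
    proof -
      obtain b d where "b \<in> T" "d \<in> T" "q = inv\<^bsub>Q\<^esub> d \<otimes>\<^bsub>Q\<^esub> b"
        using ord q unfolding order_in_def by blast
      moreover have "T \<subseteq> carrier Q" using ord by (auto simp: order_in_def dest: submonoid.subset)
      ultimately show ?thesis
        by (intro bexI[of _ d]) (auto simp: Q.m_assoc[symmetric] subset_iff)
    qed
    show "z \<in> T"
      if "z \<in> carrier Q" "c \<in> carrier Q" "\<And>n::nat. z [^]\<^bsub>Q\<^esub> n \<otimes>\<^bsub>Q\<^esub> c \<in> T" for z c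
      using maximal_order_completely_integrally_closed[OF Q.is_group max conj] that by blast
  qed (use conj acc in auto)
  obtain R where R: "R \<subseteq> poles" "\<forall>a \<in> T. finite {q \<in> R. 0 < val q a}"
    "\<forall>a \<in> T. \<forall>b \<in> T. (\<forall>q \<in> R. val q a \<le> val q b) \<longrightarrow> b \<otimes>\<^bsub>Q\<^esub> inv\<^bsub>Q\<^esub> a \<in> T"
    using exists_valuations by (elim exE conjE)
  have \<iota>T: "\<iota> a \<in> T" if "a \<in> carrier S" for a using that by (simp add: T_def)
  \<comment> \<open>The valuations are pulled back along \<open>\<iota>\<close>. A quotient lying in
    \<open>T\<close> is the image of an element of \<open>S\<close>, and injectivity turns this into
    divisibility in \<open>S\<close>.\<close>
  interpret valued_monoid S R "\<lambda>q a. val q (\<iota> a)"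
  proof
    show "a <#\<^bsub>S\<^esub> carrier S = carrier S #>\<^bsub>S\<^esub> a" if "a \<in> carrier S" for a
      using assms(2) that by (simp add: normalizing_def)
    show "val q (\<iota> (a \<otimes>\<^bsub>S\<^esub> b)) = val q (\<iota> a) + val q (\<iota> b)"
      if "q \<in> R" "a \<in> carrier S" "b \<in> carrier S" for q a b
      using that R(1) val_mult \<iota>T hom by (auto simp: hom_mult)
    show "finite {q \<in> R. 0 < val q (\<iota> a)}" if "a \<in> carrier S" for a using R(2) \<iota>T that by blast
    show "\<exists>c \<in> carrier S. b = c \<otimes>\<^bsub>S\<^esub> a"
      if a: "a \<in> carrier S" and b: "b \<in> carrier S"
        and le: "\<And>q. q \<in> R \<Longrightarrow> val q (\<iota> a) \<le> val q (\<iota> b)" for a b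
    proof -
      obtain c where c: "c \<in> carrier S" "\<iota> b \<otimes>\<^bsub>Q\<^esub> inv\<^bsub>Q\<^esub> \<iota> a = \<iota> c"
        using R(3)[rule_format, of "\<iota> a" "\<iota> b"] \<iota>T a b le by (auto simp: T_def)
      have "\<iota> (c \<otimes>\<^bsub>S\<^esub> a) = (\<iota> b \<otimes>\<^bsub>Q\<^esub> inv\<^bsub>Q\<^esub> \<iota> a) \<otimes>\<^bsub>Q\<^esub> \<iota> a"
        using c a hom by (simp add: hom_mult)
      also have "\<dots> = \<iota> b" using \<iota>T a b by (simp add: Q.m_assoc)
      finally show ?thesis using inj_onD[OF inj] a b c by (metis S.m_closed)
    qed
  qed
  show ?thesis
    using omega_p_sup_le omega_p'_sup_le by (meson enat_ord_code(4) le_less_trans)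
qed

end
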